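(* Let $H\in(1/2,1)$, $c\in(0,2^{2H-2})$, and set $\mu=2H-1$, $\nu=c\,\Gamma(2H-1)$. Let $B^{\circ,*}_n=\sum_{i=1}^nX^*_i$ for the GBP-II$^*$ process $(X^*_i)$ with parameters $H,c$, and let $N_{\mu,\nu}$ be a fractional Poisson process with parameters $\mu,\nu$. Then, as $n\to\infty$, \[ B^{\circ,*}_n/n^{\mu}\xrightarrow{d}X_\mu,\qquad N_{\mu,\nu}(n)/n^{\mu}\xrightarrow{d}X_\mu, \] where $X_\mu$ is a random variable (second family Mittag-Leffler distribution of order $\mu$) whose moment generating function is $E(e^{tX_\mu})=E_\mu(\nu t)$ for all $t\in\mathbb{R}$, with $E_\mu(z)=\sum_{k=0}^\infty \frac{z^k}{\Gamma(\mu k+1)}$ the Mittag-Leffler function.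
   Context: For a finite set $A=\{i_0<\dots<i_k\}\subset\mathbb{N}\cup\{0\}$ with $|A|\ge1$ define $L^\circ_H(A)=\prod_{j=1}^{k}|i_j-i_{j-1}|^{2H-2}$ (equal to $1$ if $|A|=1$), and for disjoint finite $A\neq\emptyset,B$ define $D^\circ_H(A,B)=\sum_{B'\subseteq B}(-1)^{|B'|}c^{|B'|}L^\circ_H(A\cup B')$. The GBP-II$^*$ process is the $\{0,1\}$-valued process $(X^*_i)_{i\in\mathbb{N}}$ with $P(\bigcap_{i\in A}\{X^*_i=1\}\cap\bigcap_{i\in B}\{X^*_i=0\})=c^{|A|}D^\circ_H(A\cup\{0\},B)$ for all disjoint finite $A,B\subset\mathbb{N}$. A fractional Poisson process (Laskin) with parameters $\mu\in(0,1)$, $\nu>0$ is a counting process $(N_{\mu,\nu}(s))_{s\ge0}$ whose one-dimensional laws have moment generating function $E(e^{tN_{\mu,\nu}(s)})=\sum_{k=0}^\infty\frac{((e^t-1)\nu s^\mu)^k}{\Gamma(\mu k+1)}$. *)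

theory Defs
  imports "HOL-Probability.Probability"
begin

definition Lcirc :: "real \<Rightarrow> nat set \<Rightarrow> real" where
  "Lcirc H A = (let xs = sorted_list_of_set A in
     \<Prod>j\<in>{1..<length xs}. \<bar>real (xs ! j) - real (xs ! (j - 1))\<bar> powr (2 * H - 2))"

definition Dcirc :: "real \<Rightarrow> real \<Rightarrow> nat set \<Rightarrow> nat set \<Rightarrow> real" where
  "Dcirc H c A B = (\<Sum>B'\<in>Pow B. (-1) ^ card B' * c ^ card B' * Lcirc H (A \<union> B'))"

definition GBP_II_star :: "real \<Rightarrow> real \<Rightarrow> 'a measure \<Rightarrow> (nat \<Rightarrow> 'a \<Rightarrow> real) \<Rightarrow> bool" where
  "GBP_II_star H c M X \<longleftrightarrow> prob_space M \<and>
     (\<forall>i\<ge>1. X i \<in> borel_measurable M \<and> (\<forall>\<omega>\<in>space M. X i \<omega> \<in> {0, 1})) \<and>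
     (\<forall>A B. finite A \<and> finite B \<and> A \<inter> B = {} \<and> A \<subseteq> {1..} \<and> B \<subseteq> {1..} \<longrightarrow>
        measure M {\<omega>\<in>space M. (\<forall>i\<in>A. X i \<omega> = 1) \<and> (\<forall>i\<in>B. X i \<omega> = 0)}
          = c ^ card A * Dcirc H c (A \<union> {0}) B)"

definition frac_poisson :: "real \<Rightarrow> real \<Rightarrow> 'a measure \<Rightarrow> (real \<Rightarrow> 'a \<Rightarrow> real) \<Rightarrow> bool" where
  "frac_poisson \<mu> \<nu> M N \<longleftrightarrow> prob_space M \<and>
     (\<forall>s\<ge>0. N s \<in> borel_measurable M) \<and>
     (\<forall>\<omega>\<in>space M. N 0 \<omega> = 0 \<and> (\<forall>s\<ge>0. N s \<omega> \<in> \<nat>) \<and>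
        (\<forall>s t. 0 \<le> s \<and> s \<le> t \<longrightarrow> N s \<omega> \<le> N t \<omega>)) \<and>
     (\<forall>s\<ge>0. \<forall>t::real. integrable M (\<lambda>\<omega>. exp (t * N s \<omega>)) \<and>
        (\<integral>\<omega>. exp (t * N s \<omega>) \<partial>M) = (\<Sum>k. ((exp t - 1) * \<nu> * s powr \<mu>) ^ k / Gamma (\<mu> * k + 1)))"

definition mittag_leffler :: "real \<Rightarrow> real \<Rightarrow> real" where
  "mittag_leffler \<mu> z = (\<Sum>k. z ^ k / Gamma (\<mu> * real k + 1))"

definition has_mgf :: "real measure \<Rightarrow> (real \<Rightarrow> real) \<Rightarrow> bool" where
  "has_mgf D g \<longleftrightarrow> (\<forall>t. integrable D (\<lambda>x. exp (t * x)) \<and> (\<integral>x. exp (t * x) \<partial>D) = g t)"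

end

theory Submission
  imports Defs "HOL-Complex_Analysis.Cauchy_Integral_Formula"
begin

text \<open>
  Put \<open>\<mu> = 2H - 1\<close>. Both processes have explicit binomial moments: for the fractional Poisson process
  \<open>E (N(s) choose k) = (\<nu> s powr \<mu>)^k / Gamma (\<mu>k + 1)\<close>, read off from its moment generating function, and for
  the GBP-II* process \<open>E (B\<^sub>n choose k)\<close> is \<open>c^k\<close> times an iterated discrete convolution of \<open>i powr (\<mu> - 1)\<close>.
  Comparing each convolution step with a Beta integral shows that this convolution is at most
  \<open>Gamma \<mu> ^ k / Gamma (\<mu>k + 1) * n powr (\<mu>k)\<close> and asymptotically equal to it.
  Since \<open>E (1 + w)^K\<close> is the power series in \<open>w\<close> with the binomial moments of \<open>K\<close> as coefficients, setting
  \<open>w = exp (it / n powr \<mu>) - 1\<close> and applying Tannery's theorem gives the limit \<open>E\<^sub>\<mu>(i\<nu>t)\<close> for both characteristic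
  functions. By uniqueness of power series this is the characteristic function of every law whose moment
  generating function is \<open>E\<^sub>\<mu>(\<nu>t)\<close>, and Levy's continuity theorem applies. Such a law exists as a
  subsequential limit of the rescaled fractional Poisson variables, whose exponential moments are bounded.
\<close>

subsection \<open>The Mittag-Leffler series and Beta sums\<close>

text \<open>Log-convexity of Gamma on \<open>[x + m, x + m + 1]\<close>, evaluated at \<open>x + 1\<close>.\<close>

lemma Gamma_add_lower:
  fixes x m :: real
  assumes "x > 0" "0 < m" "m < 1"
  shows "x * Gamma x \<le> Gamma (x + m) * (x + m) powr (1 - m)"
proof -
  have pos: "Gamma (x + m) > 0" "Gamma (x + m + 1) > 0"
    using assms by (auto intro!: Gamma_real_pos)
  have "(ln \<circ> Gamma) ((1 - (1 - m)) *\<^sub>R (x + m) + (1 - m) *\<^sub>R (x + m + 1))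
      \<le> (1 - (1 - m)) * (ln \<circ> Gamma) (x + m) + (1 - m) * (ln \<circ> Gamma) (x + m + 1)"
    using assms by (intro convex_onD[OF log_convex_Gamma_real]) auto
  also have "(1 - (1 - m)) *\<^sub>R (x + m) + (1 - m) *\<^sub>R (x + m + 1) = x + 1"
    by (simp add: algebra_simps)
  also have "x + m \<notin> \<int>\<^sub>\<le>\<^sub>0" using assms by (auto dest: nonpos_Ints_nonpos)
  then have "ln (Gamma (x + m + 1)) = ln (x + m) + ln (Gamma (x + m))"
    using assms less_imp_neq[OF pos(1)] Gamma_plus1[of "x + m"] by (simp add: ln_mult)
  then have "(1 - (1 - m)) * (ln \<circ> Gamma) (x + m) + (1 - m) * (ln \<circ> Gamma) (x + m + 1)
      = ln (Gamma (x + m) * (x + m) powr (1 - m))"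
    using assms less_imp_neq[OF pos(1)] by (simp add: ln_mult ln_powr algebra_simps)
  finally have "Gamma (x + 1) \<le> Gamma (x + m) * (x + m) powr (1 - m)"
    using assms pos by (simp add: Gamma_real_pos)
  then show ?thesis
    using assms by (subst (asm) Gamma_plus1) (auto elim!: nonpos_Ints_cases')
qed

lemma Gamma_mittag_leffler_pos:
  fixes m :: real
  shows "0 \<le> m \<Longrightarrow> Gamma (m * real k + 1) > 0"
  by (intro Gamma_real_pos) (simp add: add_nonneg_pos)

text \<open>Ratio test: by \<open>Gamma_add_lower\<close> at \<open>x = m * k + 1\<close>,
  consecutive terms have ratio at most |z| (x + m)^(1 - m) / x, which is of order k^(-m) and tends
  to 0.\<close>

lemma summable_mittag_leffler:
  fixes m z :: real
  assumes m: "0 < m" "m < 1"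
  shows "summable (\<lambda>k. z ^ k / Gamma (m * real k + 1))"
proof -
  have G: "Gamma (m * real k + 1) > 0" for k
    using m by (simp add: Gamma_mittag_leffler_pos)
  have "(\<lambda>k. (m * real k + 1 + m) powr (1 - m) / (m * real k + 1) * \<bar>z\<bar>) \<longlonglongrightarrow> 0"
    using m by real_asymp
  then have "eventually (\<lambda>k. (m * real k + 1 + m) powr (1 - m) / (m * real k + 1) * \<bar>z\<bar> < 1 / 2) sequentially"
    by (rule order_tendstoD) simp
  then obtain n where n: "\<And>k. k \<ge> n \<Longrightarrow> (m * real k + 1 + m) powr (1 - m) / (m * real k + 1) * \<bar>z\<bar> < 1 / 2"
    unfolding eventually_sequentially by blast
  show ?thesis
  proof (rule summable_ratio_test[of "1 / 2" n])
    fix k assume "k \<ge> n"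
    let ?x = "m * real k + 1"
    have x: "?x > 0" using m by (simp add: add_nonneg_pos)
    have "?x * Gamma ?x \<le> Gamma (?x + m) * (?x + m) powr (1 - m)"
      using m x by (intro Gamma_add_lower) auto
    then have "1 / Gamma (?x + m) \<le> (?x + m) powr (1 - m) / ?x / Gamma ?x"
      using G[of k] G[of "Suc k"] x by (simp add: divide_simps ac_simps distrib_left)
    then have "\<bar>z\<bar> ^ k * \<bar>z\<bar> * (1 / Gamma (?x + m)) \<le> \<bar>z\<bar> ^ k * \<bar>z\<bar> * ((?x + m) powr (1 - m) / ?x / Gamma ?x)"
      by (intro mult_left_mono) auto
    also have "\<dots> = (\<bar>z\<bar> ^ k / Gamma ?x) * ((?x + m) powr (1 - m) / ?x * \<bar>z\<bar>)" by (simp add: mult_ac)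
    also have "\<dots> \<le> (\<bar>z\<bar> ^ k / Gamma ?x) * (1 / 2)"
      using n[OF \<open>k \<ge> n\<close>] G[of k] by (intro mult_left_mono) auto
    finally show "norm (z ^ Suc k / Gamma (m * real (Suc k) + 1)) \<le> 1 / 2 * norm (z ^ k / Gamma (m * real k + 1))"
      using G[of k] G[of "Suc k"] by (simp add: abs_mult power_abs algebra_simps)
  qed simp
qed

lemma summable_mittag_leffler_complex:
  fixes z :: complex
  assumes "0 < m" "m < 1"
  shows "summable (\<lambda>k. norm (z ^ k * of_real (v ^ k / Gamma (m * real k + 1))))"
proof -
  have "Gamma (m * real k + 1) > 0" for k
    using assms by (simp add: Gamma_mittag_leffler_pos)
  then show ?thesis
    using summable_mittag_leffler[OF assms, of "norm z * \<bar>v\<bar>"]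
    by (simp add: norm_mult norm_power norm_divide power_mult_distrib power_abs abs_of_pos del: of_real_divide)
qed

section \<open>Uniqueness of power series coefficients\<close>

text \<open>Zeros of a nonzero power series are isolated, so agreement on a set accumulating at 0
  suffices. \<open>S\<close> will be a real half-line, the real axis or the imaginary axis.\<close>

lemma power_series_coeffs_eqI:
  fixes a b :: "nat \<Rightarrow> complex"
  assumes "\<And>z. summable (\<lambda>k. a k * z ^ k)" "\<And>z. summable (\<lambda>k. b k * z ^ k)"
    and eq: "\<And>z. z \<in> S \<Longrightarrow> (\<Sum>k. a k * z ^ k) = (\<Sum>k. b k * z ^ k)"
    and "0 \<in> S" "0 islimpt S"
  shows "a = b"
proof (rule ccontr)
  assume "a \<noteq> b"
  define f where "f z = (\<Sum>k. (a k - b k) * z ^ k)" for z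
  have "summable (\<lambda>k. (a k - b k) * z ^ k)" for z
    using summable_diff[OF assms(1)[of z] assms(2)[of z]] by (simp add: algebra_simps)
  then have sums: "(\<lambda>k. (a k - b k) * z ^ k) sums f z" for z
    unfolding f_def by (rule summable_sums)
  have f0: "f z = 0" if "z \<in> S" for z
    using eq[OF that] suminf_diff[OF assms(1)[of z] assms(2)[of z]]
    unfolding f_def by (simp add: algebra_simps)
  \<comment> \<open>The isolation result wants a nonzero coefficient of positive index, so the
    constant terms are settled first.\<close>
  have "a 0 - b 0 = f 0"
    unfolding f_def using powser_zero[of "\<lambda>k. a k - b k"] by simp
  then have "a 0 = b 0" using f0[OF \<open>0 \<in> S\<close>] by simp
  moreover obtain k where k: "a k \<noteq> b k" using \<open>a \<noteq> b\<close> by auto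
  ultimately have "k > 0" by (cases k) auto
  obtain s where s: "0 < s" "\<And>z. z \<in> cball 0 s - {0} \<Longrightarrow> f z \<noteq> 0"
    using powser_0_nonzero[of 1 0 "\<lambda>k. a k - b k" f k] sums f0[OF \<open>0 \<in> S\<close>] k \<open>k > 0\<close> by auto
  obtain z where "z \<in> S" "z \<noteq> 0" "dist z 0 < s"
    using \<open>0 islimpt S\<close> s(1) unfolding islimpt_approachable by auto
  with s(2)[of z] f0 show False by (simp add: dist_norm)
qed

text \<open>In Isabelle \<open>0 powr 0 = 0\<close>; the bounds below also need the value \<open>1\<close>.\<close>

definition rpow :: "real \<Rightarrow> real \<Rightarrow> real" where
  "rpow x b = (if b = 0 then 1 else x powr b)"

lemma rpow_mono: "0 \<le> x \<Longrightarrow> x \<le> y \<Longrightarrow> 0 \<le> b \<Longrightarrow> rpow x b \<le> rpow y b"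
  by (auto simp: rpow_def powr_mono2)

text \<open>The integrand of the Beta function is decreasing on the unit interval, so the sum is a Riemann sum
  bounded from above by the whole integral and from below by the integral without its first cell.\<close>

lemma sum_powr_Beta_bounds:
  fixes m b :: real
  assumes m: "0 < m" "m < 1" and b: "0 \<le> b"
  shows "(\<Sum>i=1..n. real i powr (m - 1) * rpow (real (n - i)) b) \<le> Beta m (b + 1) * real n powr (m + b)" (is ?upper)
    and "Beta m (b + 1) * real n powr (m + b) - rpow (real n) b / m
       \<le> (\<Sum>i=1..n. real i powr (m - 1) * rpow (real (n - i)) b)" (is ?lower)
proof -
  define g where "g t = t powr (m - 1) * rpow (1 - t) b" for t :: real
  \<comment> \<open>The exceptional point 1 is where \<open>rpow\<close> and \<open>powr\<close>
    differ when \<open>b = 0\<close>.\<close>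
  have g: "(g has_integral Beta m (b + 1)) {0..1}"
    using m b unfolding g_def
    by (intro has_integral_spike_finite[OF _ _ has_integral_Beta_real, of "{1}"]) (auto simp: rpow_def)
  have g_nonneg: "g t \<ge> 0" for t by (simp add: g_def rpow_def)
  \<comment> \<open>The restriction \<open>0 < s\<close> matters: \<open>0 powr (m - 1) = 0\<close>
    makes \<open>g 0 = 0\<close>, whereas \<open>g\<close> is unbounded near 0.\<close>
  have mono: "g t \<le> g s" if "0 < s" "s \<le> t" "t \<le> 1" for s t
    unfolding g_def using that m b by (intro mult_mono powr_mono2' rpow_mono) (auto simp: rpow_def)
  have "?upper \<and> ?lower"
  proof (cases "n = 0")
    case False
    then have n: "real n > 0" by simp
    have int: "g integrable_on {c..d}" if "0 \<le> c" "d \<le> 1" for c d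
      using g integrable_subinterval_real[of g 0 1 c d] that by (auto simp: integrable_on_def)
    define I where "I i = integral {real i / n .. real (Suc i) / n} g" for i
    have "sum I {..<k} = integral {0..real k / n} g" if "k \<le> n" for k
      using that
    proof (induction k)
      case (Suc k)
      then have "sum I {..<Suc k} = integral {0..real k / n} g + I k" by simp
      also have "\<dots> = integral {0..real (Suc k) / n} g"
        unfolding I_def using Suc.prems
        by (intro Henstock_Kurzweil_Integration.integral_combine int) (auto simp: divide_simps)
      finally show ?case .
    qed simp
    from this[of n] have tot: "sum I {..<n} = Beta m (b + 1)"
      using n integral_unique[OF g] by simp
    \<comment> \<open>Homogeneity of degree m - 1 + b; the extra factor n is absorbed by the mesh
      width 1 / n.\<close>
    have summand: "real i powr (m - 1) * rpow (real (n - i)) b = real n powr (m + b) * (1 / n * g (real i / n))"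
      if "i \<le> n" for i
    proof -
      have "1 - real i / n = real (n - i) / n" using that n by (simp add: field_simps of_nat_diff)
      then have "rpow (1 - real i / n) b = rpow (real (n - i)) b / real n powr b"
        using n by (simp add: rpow_def powr_divide)
      moreover have "real n powr (m + b) = real n * real n powr (m - 1) * real n powr b"
        using n by (simp add: powr_diff powr_add)
      ultimately show ?thesis using n unfolding g_def
        by (simp add: powr_divide mult_ac)
    qed
    have sum_eq: "(\<Sum>i=1..n. real i powr (m - 1) * rpow (real (n - i)) b)
       = real n powr (m + b) * (\<Sum>i<n. 1 / n * g (real (Suc i) / n))"
      unfolding sum_distrib_left using summand
      by (simp add: sum.atLeast_Suc_atMost_Suc_shift lessThan_Suc_atMost sum.atLeast1_atMost_eq)
    \<comment> \<open>Open cells keep 0, where \<open>mono\<close> fails, out of the first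
      cell.\<close>
    have open_iv: "g integrable_on {a<..<d}" "integral {a<..<d} g = integral {a..d} g" if "0 \<le> a" "d \<le> 1" for a d
      using int[OF that] by (auto simp: integrable_on_open_interval_real integral_open_interval_real)
    have const_iv: "((\<lambda>t. c) has_integral (d - a) * c) {a<..<d}" if "a \<le> d" for a d c :: real
      using has_integral_const_real[of c a d] that by (simp add: has_integral_Icc_iff_Ioo)
    have le: "1 / n * g (real (Suc i) / n) \<le> I i" if "i < n" for i
    proof -
      have "0 \<le> real i / n" by simp
      then have pos: "0 < t" if "real i / n < t" for t
        using that by (rule le_less_trans)
      have "(real (Suc i) / n - real i / n) * g (real (Suc i) / n) \<le> integral {real i / n<..<real (Suc i) / n} g"
        using that n pos
        by (intro has_integral_le[OF const_iv integrable_integral] open_iv mono)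
           (auto simp: divide_right_mono)
      then show ?thesis using that n open_iv(2)[of "real i / n" "real (Suc i) / n"]
        by (simp add: I_def field_simps)
    qed
    \<comment> \<open>The node that gives the minimum on its own cell is the left endpoint of the
      next cell, where it gives the maximum. Only cell 0 is not bounded this way.\<close>
    have ge: "I (Suc i) \<le> 1 / n * g (real (Suc i) / n)" if "Suc i < n" for i
    proof -
      have "real (Suc (Suc i)) / n \<le> 1" using that by simp
      then have le1: "t \<le> 1" if "t < real (Suc (Suc i)) / n" for t
        using that by linarith
      have "integral {real (Suc i) / n<..<real (Suc (Suc i)) / n} g
          \<le> (real (Suc (Suc i)) / n - real (Suc i) / n) * g (real (Suc i) / n)"
        using that n le1
        by (intro has_integral_le[OF integrable_integral const_iv] open_iv mono)
           (auto simp: divide_right_mono less_imp_le)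
      then show ?thesis using that n open_iv(2)[of "real (Suc i) / n" "real (Suc (Suc i)) / n"]
        by (simp add: I_def field_simps)
    qed
    \<comment> \<open>On the first cell the second factor is at most 1, so the integral is at most
      that of t^(m - 1), namely n^(-m) / m. Rescaling by n^(m + b) yields the error term of the
      lower bound.\<close>
    have "I 0 \<le> (1 / n) powr (m - 1 + 1) / (m - 1 + 1)"
      unfolding I_def of_nat_0 div_0 of_nat_Suc add_0_right
    proof (rule has_integral_le[OF integrable_integral has_integral_powr_from_0])
      fix t assume t: "t \<in> {0..1 / real n}"
      have "1 / real n \<le> 1" using n by simp
      with t have "t \<le> 1" by (auto intro: order_trans)
      then have "rpow (1 - t) b \<le> 1" using t b by (auto simp: rpow_def intro!: powr_le1)
      then show "g t \<le> t powr (m - 1)" unfolding g_def by (simp add: mult_left_le)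
    qed (use m n int in \<open>auto simp: divide_simps\<close>)
    then have I0: "real n powr (m + b) * I 0 \<le> rpow (real n) b / m"
      using n m by (simp add: rpow_def powr_divide powr_add field_simps)
    have "(\<Sum>i<n. 1 / n * g (real (Suc i) / n)) \<le> Beta m (b + 1)"
      unfolding tot[symmetric] by (intro sum_mono le) auto
    then have 1: ?upper unfolding sum_eq using n
      by (subst mult.commute) (intro mult_right_mono, auto)
    obtain k where k: "n = Suc k" using \<open>n \<noteq> 0\<close> by (cases n) auto
    have "Beta m (b + 1) - I 0 = (\<Sum>i<k. I (Suc i))"
      unfolding tot[symmetric] k by (subst sum.lessThan_Suc_shift) simp
    also have "\<dots> \<le> (\<Sum>i<k. 1 / n * g (real (Suc i) / n))"
      using k by (intro sum_mono ge) auto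
    also have "\<dots> \<le> (\<Sum>i<n. 1 / n * g (real (Suc i) / n))"
      using k by (intro sum_mono2) (auto simp: g_nonneg)
    finally have "real n powr (m + b) * (Beta m (b + 1) - I 0)
        \<le> real n powr (m + b) * (\<Sum>i<n. 1 / n * g (real (Suc i) / n))"
      by (intro mult_left_mono) auto
    then have ?lower unfolding sum_eq using I0 by (simp add: algebra_simps)
    with 1 show ?thesis by blast
  qed (use m b in \<open>auto simp: rpow_def\<close>)
  then show ?upper ?lower by auto
qed

subsection \<open>Sums over gap products\<close>

lemma Lcirc_singleton [simp]: "Lcirc H {x} = 1"
  by (simp add: Lcirc_def)

text \<open>A new minimum is a new head of the sorted list, so it contributes exactly one factor:
  the gap to the old minimum.\<close>

lemma Lcirc_insert_insert:
  assumes "finite A" "x < y" "\<And>a. a \<in> A \<Longrightarrow> y < a"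
  shows "Lcirc H (insert x (insert y A)) = real (y - x) powr (2 * H - 2) * Lcirc H (insert y A)"
proof -
  have x: "x < a" if "a \<in> A" for a
    using assms(2) assms(3)[OF that] by linarith
  let ?xs = "sorted_list_of_set A"
  have ys: "sorted_list_of_set (insert y A) = y # ?xs"
    using assms by (subst sorted_list_of_set_unique[symmetric]) (auto simp: card_insert_if)
  have xs: "sorted_list_of_set (insert x (insert y A)) = x # y # ?xs"
    using assms x by (subst sorted_list_of_set_unique[symmetric]) (auto simp: card_insert_if)
  have split: "prod f {1..<Suc (Suc l)} = f 1 * (\<Prod>j\<in>{1..<Suc l}. f (Suc j))" for f :: "nat \<Rightarrow> real" and l
    by (subst prod.atLeast_Suc_lessThan) (simp, simp only: One_nat_def prod.shift_bounds_Suc_ivl)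
  have "Lcirc H (insert x (insert y A)) = \<bar>real y - real x\<bar> powr (2 * H - 2) * Lcirc H (insert y A)"
    unfolding Lcirc_def ys xs Let_def length_Cons split
    by (intro arg_cong2[of _ _ _ _ "(*)"] prod.cong) (auto simp: nth_Cons')
  then show ?thesis using \<open>x < y\<close> by (simp add: of_nat_diff)
qed

text \<open>This is the sum, over all k-tuples of positive gaps with total at most n, of the product
  of their (m - 1)-th powers; \<open>i\<close> is the first gap.\<close>

fun gap_sum :: "real \<Rightarrow> nat \<Rightarrow> nat \<Rightarrow> real" where
  "gap_sum m 0 n = 1"
| "gap_sum m (Suc k) n = (\<Sum>i=1..n. real i powr (m - 1) * gap_sum m k (n - i))"

lemma gap_sum_nonneg: "gap_sum m k n \<ge> 0"
  by (induction k arbitrary: n) (auto intro!: sum_nonneg)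

text \<open>Induction on \<open>k\<close> with the left end \<open>x\<close> arbitrary: a nonempty
  set corresponds to its minimum \<open>y\<close> together with the rest, which lies to the right of
  \<open>y\<close>. The exponent 2H - 2 is m - 1 for m = 2H - 1.\<close>

lemma sum_Lcirc:
  "(\<Sum>A | A \<subseteq> {x<..n} \<and> card A = k. Lcirc H (insert x A)) = gap_sum (2 * H - 1) k (n - x)"
proof (induction k arbitrary: x)
  case 0
  have "{A. A \<subseteq> {x<..n} \<and> card A = 0} = {{}}"
    by (auto dest: finite_subset)
  then show ?case by simp
next
  case (Suc k)
  let ?S = "\<lambda>k x. {A. A \<subseteq> {x<..n} \<and> card A = k}"
  have fin: "finite A" if "A \<subseteq> {y<..n}" for A y
    using that finite_subset by blast
  have "(\<Sum>A\<in>?S (Suc k) x. Lcirc H (insert x A))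
      = (\<Sum>(y, A)\<in>(SIGMA y:{x<..n}. ?S k y). real (y - x) powr (2 * H - 2) * Lcirc H (insert y A))"
  proof (rule sum.reindex_bij_witness[of _ "\<lambda>(y, A). insert y A" "\<lambda>A. (Min A, A - {Min A})"])
    fix A assume A: "A \<in> ?S (Suc k) x"
    then have f: "finite A" "A \<noteq> {}" using fin by auto
    define y where "y = Min A"
    have y: "y \<in> A" "\<And>a. a \<in> A - {y} \<Longrightarrow> y < a"
      using f Min_le[OF f(1)] by (auto simp: y_def le_less)
    then have ins: "insert y (A - {y}) = A" by (intro insert_Diff)
    then show "(case (Min A, A - {Min A}) of (y, A) \<Rightarrow> insert y A) = A" by (simp add: y_def)
    have "y \<in> {x<..n}" "A - {y} \<subseteq> {y<..n}" "card (A - {y}) = k"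
      using A y f by auto
    then show "(Min A, A - {Min A}) \<in> (SIGMA y:{x<..n}. ?S k y)"
      unfolding y_def[symmetric] by simp
    have "Lcirc H (insert x (insert y (A - {y}))) = real (y - x) powr (2 * H - 2) * Lcirc H (insert y (A - {y}))"
      using A y f by (intro Lcirc_insert_insert) auto
    then show "(case (Min A, A - {Min A}) of (y, A) \<Rightarrow> real (y - x) powr (2 * H - 2) * Lcirc H (insert y A))
        = Lcirc H (insert x A)"
      unfolding y_def[symmetric] by (simp only: ins prod.case)
  next
    fix p assume p: "p \<in> (SIGMA y:{x<..n}. ?S k y)"
    obtain y A where [simp]: "p = (y, A)" by (cases p)
    have A: "y \<in> {x<..n}" "A \<subseteq> {y<..n}" "card A = k" "finite A" using p fin by auto
    have "Min (insert y A) = y" using A by (intro Min_eqI) auto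
    then show "(Min (case p of (y, A) \<Rightarrow> insert y A), (case p of (y, A) \<Rightarrow> insert y A) - {Min (case p of (y, A) \<Rightarrow> insert y A)}) = p"
      using A by auto
    show "(case p of (y, A) \<Rightarrow> insert y A) \<in> ?S (Suc k) x"
      using A by (auto simp: card_insert_if)
  qed
  also have "\<dots> = (\<Sum>y\<in>{x<..n}. \<Sum>A\<in>?S k y. real (y - x) powr (2 * H - 2) * Lcirc H (insert y A))"
    by (intro sum.Sigma[symmetric]) (auto intro: finite_subset[of _ "Pow {_<..n}"])
  also have "\<dots> = (\<Sum>y\<in>{x<..n}. real (y - x) powr (2 * H - 2) * gap_sum (2 * H - 1) k (n - y))"
    by (simp add: sum_distrib_left[symmetric] Suc.IH)
  also have "\<dots> = (\<Sum>i=1..n-x. real i powr (2 * H - 2) * gap_sum (2 * H - 1) k (n - x - i))"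
    by (rule sum.reindex_bij_witness[of _ "\<lambda>i. x + i" "\<lambda>y. y - x"]) auto
  finally show ?case by (simp add: algebra_simps)
qed

section \<open>Growth of the gap sums\<close>

lemma gap_sum_eq_0: "n < k \<Longrightarrow> gap_sum m k n = 0"
proof (induction k arbitrary: n)
  case (Suc k)
  then show ?case by (auto intro!: sum.neutral)
qed simp

text \<open>The denominator of one coefficient cancels against a Gamma factor of the Beta value, so
  the coefficients telescope under repeated convolution.\<close>

lemma gap_coeff_Suc:
  fixes m :: real
  assumes "0 < m"
  shows "Gamma m ^ k / Gamma (m * real k + 1) * Beta m (m * real k + 1)
    = Gamma m ^ Suc k / Gamma (m * real (Suc k) + 1)"
proof -
  have "Gamma (m * real k + 1) > 0"
    using assms by (simp add: Gamma_mittag_leffler_pos)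
  then show ?thesis by (simp add: Beta_def algebra_simps)
qed

text \<open>Each convolution multiplies the bound by exactly the Beta factor of
  \<open>gap_coeff_Suc\<close>, with no loss. Hence it holds for every \<open>n\<close> and can
  serve as the dominating sequence in Tannery's theorem.\<close>

lemma gap_sum_upper:
  assumes m: "0 < m" "m < 1"
  shows "gap_sum m k n \<le> Gamma m ^ k / Gamma (m * real k + 1) * rpow (real n) (m * real k)"
proof (induction k arbitrary: n)
  case (Suc k)
  let ?C = "Gamma m ^ k / Gamma (m * real k + 1)"
  have C: "?C \<ge> 0" using m less_imp_le[OF Gamma_mittag_leffler_pos[of m k]] less_imp_le[OF Gamma_real_pos[of m]] by simp
  have "gap_sum m (Suc k) n \<le> (\<Sum>i=1..n. real i powr (m - 1) * (?C * rpow (real (n - i)) (m * real k)))"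
    unfolding gap_sum.simps by (intro sum_mono mult_left_mono Suc.IH) auto
  also have "\<dots> = ?C * (\<Sum>i=1..n. real i powr (m - 1) * rpow (real (n - i)) (m * real k))"
    by (simp add: sum_distrib_left mult_ac)
  also have "\<dots> \<le> ?C * (Beta m (m * real k + 1) * real n powr (m + m * real k))"
    using m C by (intro mult_left_mono sum_powr_Beta_bounds) auto
  also have "\<dots> = (?C * Beta m (m * real k + 1)) * real n powr (m + m * real k)"
    by simp
  also have "\<dots> = Gamma m ^ Suc k / Gamma (m * real (Suc k) + 1) * rpow (real n) (m * real (Suc k))"
    using m add_pos_nonneg[of m "m * real k"] unfolding gap_coeff_Suc[OF m(1)]
    by (simp add: rpow_def algebra_simps)
  finally show ?case .
qed (simp add: rpow_def)

text \<open>Passing from \<open>k\<close> to \<open>Suc k\<close> creates two errors: the first-cell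
  loss in the Beta sum and the convolution of the previous error. Both are of order n^(m k), a
  factor n^m below the leading term.\<close>

lemma gap_sum_lower:
  assumes m: "0 < m" "m < 1"
  shows "\<exists>R\<ge>0. \<forall>n. Gamma m ^ k / Gamma (m * real k + 1) * rpow (real n) (m * real k)
    - R * rpow (real n) (m * real (k - 1)) \<le> gap_sum m k n"
proof (induction k)
  case 0
  show ?case by (auto simp: rpow_def)
next
  case (Suc k)
  let ?C = "Gamma m ^ k / Gamma (m * real k + 1)"
  have C: "?C \<ge> 0" using m less_imp_le[OF Gamma_mittag_leffler_pos[of m k]] less_imp_le[OF Gamma_real_pos[of m]] by simp
  let ?S = "\<lambda>n b. \<Sum>i=1..n. real i powr (m - 1) * rpow (real (n - i)) b"
  show ?case
  proof (cases "k = 0")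
    \<comment> \<open>Truncated subtraction gives \<open>k - 1 = 0\<close> here, so the exponent
      identity \<open>e\<close> used below would fail.\<close>
    case True
    have "Beta m 1 * real n powr m - 1 / m \<le> gap_sum m 1 n" for n
      using sum_powr_Beta_bounds(2)[OF m, of 0 n] by (simp add: rpow_def)
    then show ?thesis using True m gap_coeff_Suc[OF m(1), of 0]
      by (intro exI[of _ "1 / m"]) (auto simp: rpow_def)
  next
    case False
    obtain R where R: "R \<ge> 0" "\<And>n. ?C * rpow (real n) (m * real k) - R * rpow (real n) (m * real (k - 1)) \<le> gap_sum m k n"
      using Suc.IH by blast
    let ?B = "Beta m (m * real (k - 1) + 1)"
    have B: "?B \<ge> 0" using m Gamma_real_pos[of m] Gamma_mittag_leffler_pos[of m "k - 1"] Gamma_real_pos[of "m + (m * real (k - 1) + 1)"]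
      by (simp add: Beta_def add_pos_nonneg)
    \<comment> \<open>In the new constant, \<open>?C / m\<close> is the first-cell loss times the
      leading coefficient, and \<open>R * ?B\<close> bounds the convolved old error by the upper
      Beta estimate.\<close>
    have "Gamma m ^ Suc k / Gamma (m * real (Suc k) + 1) * rpow (real n) (m * real (Suc k))
        - (?C / m + R * ?B) * rpow (real n) (m * real (Suc k - 1)) \<le> gap_sum m (Suc k) n" for n
    proof -
      have e: "m + m * real (k - 1) = m * real k"
        using False by (simp add: of_nat_diff algebra_simps)
      have "Gamma m ^ Suc k / Gamma (m * real (Suc k) + 1) * rpow (real n) (m * real (Suc k))
          - (?C / m + R * ?B) * rpow (real n) (m * real (Suc k - 1))
        = ?C * (Beta m (m * real k + 1) * real n powr (m + m * real k) - rpow (real n) (m * real k) / m)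
          - R * (?B * real n powr (m + m * real (k - 1)))"
        unfolding gap_coeff_Suc[OF m(1), symmetric] e using m False add_pos_nonneg[of m "m * real k"]
        by (simp add: rpow_def algebra_simps)
      also have "\<dots> \<le> ?C * ?S n (m * real k) - R * ?S n (m * real (k - 1))"
        using m C R(1) by (intro diff_mono mult_left_mono sum_powr_Beta_bounds) auto
      also have "\<dots> = (\<Sum>i=1..n. real i powr (m - 1) *
          (?C * rpow (real (n - i)) (m * real k) - R * rpow (real (n - i)) (m * real (k - 1))))"
        by (simp add: sum_distrib_left sum_subtractf algebra_simps)
      also have "\<dots> \<le> gap_sum m (Suc k) n"
        unfolding gap_sum.simps by (intro sum_mono mult_left_mono R(2)) auto
      finally show ?thesis .
    qed
    moreover have "?C / m + R * ?B \<ge> 0"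
      by (rule add_nonneg_nonneg[OF divide_nonneg_pos[OF C m(1)] mult_nonneg_nonneg[OF R(1) B]])
    ultimately show ?thesis by blast
  qed
qed

text \<open>Squeeze between the two bounds; relative to the leading term the error is of order
  n^(-m).\<close>

lemma gap_sum_tendsto:
  assumes m: "0 < m" "m < 1"
  shows "(\<lambda>n. gap_sum m k n / real n powr (m * real k)) \<longlonglongrightarrow> Gamma m ^ k / Gamma (m * real k + 1)"
    (is "_ \<longlonglongrightarrow> ?C")
proof (cases "k = 0")
  case True
  have "\<forall>\<^sub>F n in sequentially. gap_sum m k n / real n powr (m * real k) = ?C"
    using eventually_gt_at_top[of 0] by eventually_elim (auto simp: True)
  then show ?thesis by (rule tendsto_eventually)
next
  case False
  obtain R where R: "\<And>n. ?C * rpow (real n) (m * real k) - R * rpow (real n) (m * real (k - 1)) \<le> gap_sum m k n"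
    using gap_sum_lower[OF m] by blast
  show ?thesis
  proof (rule tendsto_sandwich[of "\<lambda>n. ?C - R * real n powr (- m)" _ _ "\<lambda>_. ?C"])
    have "(\<lambda>n. real n powr (- m)) \<longlonglongrightarrow> 0"
      using m by real_asymp
    then show "(\<lambda>n. ?C - R * real n powr (- m)) \<longlonglongrightarrow> ?C"
      using tendsto_diff[OF tendsto_const tendsto_mult_right_zero, of _ sequentially ?C R] by simp
    show "\<forall>\<^sub>F n in sequentially. ?C - R * real n powr (- m) \<le> gap_sum m k n / real n powr (m * real k)"
      using eventually_gt_at_top[of 0]
    proof eventually_elim
      case (elim n)
      have "rpow (real n) (m * real (k - 1)) = real n powr (- m) * real n powr (m * real k)"
        using elim False by (auto simp: rpow_def powr_add[symmetric] of_nat_diff algebra_simps)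
      then show ?case using elim R[of n] False m
        by (simp add: rpow_def field_simps)
    qed
    show "\<forall>\<^sub>F n in sequentially. gap_sum m k n / real n powr (m * real k) \<le> ?C"
      using eventually_gt_at_top[of 0]
    proof eventually_elim
      case (elim n)
      then show ?case using gap_sum_upper[OF m, of k n] m False
        by (simp add: rpow_def field_simps)
    qed
  qed simp
qed

subsection \<open>Characteristic functions as power series\<close>

lemma cmod_iexp_minus_1_le: "cmod (iexp x - 1) \<le> \<bar>x\<bar>"
  using iexp_approx1[of x 0] by simp

text \<open>The Taylor remainder of exp(ix) after the linear term is at most x^2 / 2. At x = t /
  n^m, multiplied by n^m, this is t^2 / 2 * n^(-m).\<close>

lemma scaled_iexp_tendsto:
  assumes "0 < m"
  shows "(\<lambda>n. (iexp (t / real n powr m) - 1) * of_real (real n powr m)) \<longlonglongrightarrow> \<i> * of_real t"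
proof (rule Lim_transform_bound[where g = "\<lambda>n. t\<^sup>2 / 2 * real n powr (- m)", THEN LIM_zero_cancel], goal_cases)
  case 1
  show ?case using eventually_gt_at_top[of 0]
  proof eventually_elim
    case (elim n)
    let ?s = "real n powr m"
    have s: "?s > 0" using elim by simp
    have "(iexp (t / ?s) - 1) * of_real ?s - \<i> * of_real t = (iexp (t / ?s) - (1 + \<i> * of_real (t / ?s))) * of_real ?s"
      using s elim by (simp add: field_simps)
    then have "cmod ((iexp (t / ?s) - 1) * of_real ?s - \<i> * of_real t) = cmod (iexp (t / ?s) - (1 + \<i> * of_real (t / ?s))) * ?s"
      using s by (simp only: norm_mult) simp
    also have "\<dots> \<le> (t / ?s)\<^sup>2 / 2 * ?s"
      using iexp_approx1[of "t / ?s" 1] s by (intro mult_right_mono) (auto simp: numeral_2_eq_2)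
    also have "\<dots> = t\<^sup>2 / 2 * real n powr (- m)"
      using s elim by (simp add: powr_minus field_simps power2_eq_square)
    finally show ?case using elim by (simp add: abs_mult)
  qed
next
  case 2
  have "(\<lambda>n. real n powr (- m)) \<longlonglongrightarrow> 0" using assms by real_asymp
  then show ?case by (rule tendsto_mult_right_zero)
qed

text \<open>Tannery's theorem. Since |exp(ix) - 1| is at most |x|, the powers of n cancel and the
  k-th term is bounded by |t|^k \<open>c k\<close> for all n > 0; \<open>scaled_iexp_tendsto\<close>
  gives the termwise limits.\<close>

lemma scaled_char_tendsto:
  fixes b :: "nat \<Rightarrow> nat \<Rightarrow> real" and c :: "nat \<Rightarrow> real"
  assumes m: "0 < m"
    and bound: "\<And>n k. n > 0 \<Longrightarrow> \<bar>b n k\<bar> \<le> c k * real n powr (m * real k)"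
    and lim: "\<And>k. (\<lambda>n. b n k / real n powr (m * real k)) \<longlonglongrightarrow> c k"
    and summ: "summable (\<lambda>k. \<bar>t\<bar> ^ k * c k)"
  shows "(\<lambda>n. \<Sum>k. (iexp (t / real n powr m) - 1) ^ k * of_real (b n k)) \<longlonglongrightarrow> (\<Sum>k. (\<i> * of_real t) ^ k * of_real (c k))"
proof -
  have powr_k: "(real n powr m) ^ k = real n powr (m * real k)" if "n > 0" for n k
    using that by (simp add: powr_powr[symmetric] powr_realpow)
  have 1: "(\<lambda>n. (iexp (t / real n powr m) - 1) ^ k * of_real (b n k)) \<longlonglongrightarrow> (\<i> * of_real t) ^ k * of_real (c k)" for k
  proof (rule Lim_transform_eventually)
    show "(\<lambda>n. ((iexp (t / real n powr m) - 1) * of_real (real n powr m)) ^ k * of_real (b n k / real n powr (m * real k)))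
        \<longlonglongrightarrow> (\<i> * of_real t) ^ k * of_real (c k)"
      by (intro tendsto_mult tendsto_power tendsto_of_real lim scaled_iexp_tendsto m)
    show "\<forall>\<^sub>F n in sequentially. ((iexp (t / real n powr m) - 1) * of_real (real n powr m)) ^ k
        * of_real (b n k / real n powr (m * real k)) = (iexp (t / real n powr m) - 1) ^ k * of_real (b n k)"
      using eventually_gt_at_top[of 0]
    proof eventually_elim
      case (elim n)
      then show ?case
        unfolding power_mult_distrib of_real_power[symmetric] powr_k[OF elim] by simp
    qed
  qed
  have 2: "norm ((iexp (t / real n powr m) - 1) ^ k * of_real (b n k)) \<le> \<bar>t\<bar> ^ k * c k" if "n > 0" for k n
  proof -
    have "norm ((iexp (t / real n powr m) - 1) ^ k * complex_of_real (b n k)) \<le> \<bar>t / real n powr m\<bar> ^ k * (c k * real n powr (m * real k))"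
      unfolding norm_mult norm_power norm_of_real
      by (intro mult_mono power_mono cmod_iexp_minus_1_le bound that) auto
    also have "\<dots> = \<bar>t\<bar> ^ k * c k"
      using that by (simp add: abs_div power_divide powr_k)
    finally show ?thesis .
  qed
  have "\<forall>\<^sub>F (k, n) in at_top \<times>\<^sub>F sequentially. norm ((iexp (t / real n powr m) - 1) ^ k * of_real (b n k)) \<le> \<bar>t\<bar> ^ k * c k"
    using 2 by (intro eventually_prod_sequentially[THEN iffD2] exI[of _ 1]) auto
  from tannerys_theorem[OF 1 this summ] show ?thesis by simp
qed

section \<open>Expectations of power series\<close>

text \<open>The partial sums of the L1 norms stay below the integral of \<open>h\<close>, so the
  series of L1 norms converges and sum and integral may be exchanged.\<close>

lemma sums_integral_dominated:
  fixes f :: "nat \<Rightarrow> 'a \<Rightarrow> 'b::{banach,second_countable_topology}" and h :: "'a \<Rightarrow> real"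
  assumes [measurable]: "\<And>k. f k \<in> borel_measurable M"
    and h: "integrable M h"
    and summ: "\<And>x. summable (\<lambda>k. norm (f k x))"
    and le: "\<And>x. (\<Sum>k. norm (f k x)) \<le> h x"
  shows "(\<lambda>k. \<integral>x. f k x \<partial>M) sums (\<integral>x. (\<Sum>k. f k x) \<partial>M)"
proof -
  have part: "(\<Sum>k<n. norm (f k x)) \<le> h x" for n x
    using sum_le_suminf[OF summ, of "{..<n}" x] le[of x] by simp
  have intf: "integrable M (f k)" for k
  proof (rule Bochner_Integration.integrable_bound[OF h])
    have "norm (f k x) \<le> norm (h x)" for x
      using part[where n = "Suc k" and x = x] sum_nonneg[of "{..<k}" "\<lambda>k. norm (f k x)"] by simp
    then show "AE x in M. norm (f k x) \<le> norm (h x)" by simp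
  qed simp
  have "summable (\<lambda>k. \<integral>x. norm (f k x) \<partial>M)"
  proof (rule summableI_nonneg_bounded)
    fix n
    have "(\<Sum>k<n. \<integral>x. norm (f k x) \<partial>M) = (\<integral>x. (\<Sum>k<n. norm (f k x)) \<partial>M)"
      using intf by (intro Bochner_Integration.integral_sum[symmetric]) auto
    also have "\<dots> \<le> (\<integral>x. h x \<partial>M)"
      using intf h part by (intro integral_mono Bochner_Integration.integrable_sum) auto
    finally show "(\<Sum>k<n. \<integral>x. norm (f k x) \<partial>M) \<le> (\<integral>x. h x \<partial>M)" .
  qed simp
  then show "(\<lambda>k. \<integral>x. f k x \<partial>M) sums (\<integral>x. (\<Sum>k. f k x) \<partial>M)"
    using summ by (intro sums_integral intf) auto
qed

text \<open>Termwise integration of the binomial theorem; the norms of the terms sum to (1 + |w|)^K,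
  which is integrable by assumption.\<close>

lemma sums_one_plus_power_expectation:
  fixes K :: "'a \<Rightarrow> nat" and w :: complex
  assumes [measurable]: "K \<in> measurable M (count_space UNIV)"
    and int: "\<And>r::real. r \<ge> 0 \<Longrightarrow> integrable M (\<lambda>x. (1 + r) ^ K x)"
  shows "(\<lambda>k. of_real (\<integral>x. real (K x choose k) \<partial>M) * w ^ k) sums (\<integral>x. (1 + w) ^ K x \<partial>M)"
proof -
  let ?f = "\<lambda>k x. of_nat (K x choose k) * w ^ k :: complex"
  \<comment> \<open>Used over two fields: at \<open>w\<close> for the series itself and at
    \<open>cmod w\<close> for the sum of norms.\<close>
  have fin: "(\<lambda>k. of_nat (K x choose k) * v ^ k) sums (1 + v) ^ K x" for x and v :: "'b::{real_normed_field,banach}"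
  proof -
    have "(\<lambda>k. of_nat (K x choose k) * v ^ k) sums (\<Sum>k\<le>K x. of_nat (K x choose k) * v ^ k)"
      by (rule sums_finite) (auto simp: binomial_eq_0)
    then show ?thesis using binomial_ring[of v 1 "K x"] by (simp add: add.commute)
  qed
  have norm_f: "(\<lambda>k. norm (?f k x)) sums (1 + cmod w) ^ K x" for x
    using fin[of x "cmod w"] by (simp add: norm_mult norm_power)
  have "(\<lambda>k. \<integral>x. ?f k x \<partial>M) sums (\<integral>x. (\<Sum>k. ?f k x) \<partial>M)"
    using norm_f int[of "cmod w"] by (intro sums_integral_dominated) (auto simp: sums_iff)
  moreover have "(\<integral>x. ?f k x \<partial>M) = of_real (\<integral>x. real (K x choose k) \<partial>M) * w ^ k" for k
    by (simp flip: integral_complex_of_real)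
  ultimately show ?thesis by (simp only: sums_unique[OF fin, symmetric])
qed

lemma exp_abs_le: "exp \<bar>x\<bar> \<le> exp x + exp (- x :: real)"
  by (auto simp: abs_if)

text \<open>The norms of the exponential series sum to exp |z x|, which is dominated by exponentials
  of both signs. Real \<open>z\<close> gives the moment generating function, imaginary
  \<open>z\<close> the characteristic function.\<close>

lemma sums_exp_moments:
  fixes z :: complex
  assumes "real_distribution D" and int: "\<And>t::real. integrable D (\<lambda>x. exp (t * x))"
  shows "(\<lambda>k. of_real ((\<integral>x. x ^ k \<partial>D) / fact k) * z ^ k) sums (\<integral>x. exp (z * of_real x) \<partial>D)"
proof -
  interpret real_distribution D by fact
  let ?f = "\<lambda>k x. of_real x ^ k * (z ^ k / fact k) :: complex"
  have f: "(\<lambda>k. ?f k x) sums exp (z * of_real x)" for x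
    using exp_converges[of "z * of_real x"]
    by (simp add: power_mult_distrib scaleR_conv_of_real field_simps)
  have norm_f: "(\<lambda>k. norm (?f k x)) sums exp \<bar>cmod z * x\<bar>" for x
    using exp_converges[of "\<bar>cmod z * x\<bar>"]
    by (simp add: norm_mult norm_power norm_divide power_mult_distrib abs_mult field_simps)
  have "(\<lambda>k. \<integral>x. ?f k x \<partial>D) sums (\<integral>x. (\<Sum>k. ?f k x) \<partial>D)"
  proof (rule sums_integral_dominated)
    show "integrable D (\<lambda>x. exp (cmod z * x) + exp (- cmod z * x))"
      by (intro Bochner_Integration.integrable_add int)
    show "(\<Sum>k. norm (?f k x)) \<le> exp (cmod z * x) + exp (- cmod z * x)" for x
      using sums_unique[OF norm_f[of x]] exp_abs_le[of "cmod z * x"] by simp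
  qed (use norm_f in \<open>auto simp: sums_iff\<close>)
  moreover have "(\<integral>x. ?f k x \<partial>D) = of_real ((\<integral>x. x ^ k \<partial>D) / fact k) * z ^ k" for k
    by (simp flip: integral_complex_of_real)
  ultimately show ?thesis by (simp only: sums_unique[OF f, symmetric])
qed

section \<open>Tightness and weak subsequential limits\<close>

text \<open>Markov's inequality for exp(x) + exp(-x) gives tightness. Exponential integrability
  passes to the limit because truncated exponentials are bounded and continuous with integrals at
  most \<open>B t\<close>.\<close>

lemma tight_weak_limit_exp:
  fixes \<mu> :: "nat \<Rightarrow> real measure" and B :: "real \<Rightarrow> real"
  assumes \<mu>: "\<And>n. real_distribution (\<mu> n)"
    and int: "\<And>n t. integrable (\<mu> n) (\<lambda>x. exp (t * x))"
    and bound: "\<And>n t. (\<integral>x. exp (t * x) \<partial>\<mu> n) \<le> B t"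
  obtains r D where "strict_mono (r :: nat \<Rightarrow> nat)" "real_distribution D" "weak_conv_m (\<mu> \<circ> r) D"
    "\<And>t. integrable D (\<lambda>x. exp (t * x))"
proof -
  interpret \<mu>: real_distribution "\<mu> n" for n by fact
  have "tight \<mu>"
    unfolding tight_def
  proof (intro conjI allI impI \<mu>)
    fix e :: real assume e: "e > 0"
    let ?u = "\<lambda>x::real. exp (1 * x) + exp (- 1 * x)"
    \<comment> \<open>The absolute value and the summand 1 give both \<open>R > 0\<close> and the
      strict inequality without sign information on \<open>B\<close>.\<close>
    define R where "R = \<bar>B 1 + B (- 1)\<bar> / e + 1"
    have "R > 0" using e by (simp add: R_def add_nonneg_pos)
    moreover have "B 1 + B (- 1) < e * R" using e by (simp add: R_def distrib_left)
    ultimately have R: "R > 0" "(B 1 + B (- 1)) / R < e" by (simp_all add: pos_divide_less_eq)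
    have "measure (\<mu> n) {- R<..R} > 1 - e" for n
    proof -
      have iu: "integrable (\<mu> n) ?u" by (intro Bochner_Integration.integrable_add int)
      have "measure (\<mu> n) (UNIV - {- R<..R}) \<le> measure (\<mu> n) {x \<in> space (\<mu> n). ?u x \<ge> R}"
      proof (rule \<mu>.finite_measure_mono)
        have "R \<le> ?u x" if "x \<notin> {- R<..R}" for x
        proof -
          have "R \<le> \<bar>x\<bar>" using that by auto
          also have "\<dots> \<le> exp \<bar>x\<bar>" using exp_ge_add_one_self[of "\<bar>x\<bar>"] by linarith
          also have "\<dots> \<le> ?u x" using exp_abs_le[of x] by simp
          finally show ?thesis .
        qed
        then show "UNIV - {- R<..R} \<subseteq> {x \<in> space (\<mu> n). R \<le> ?u x}" by auto
      qed simp
      also have "\<dots> \<le> (\<integral>x. ?u x \<partial>\<mu> n) / R"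
        using R(1) by (intro integral_Markov_inequality_measure[of _ _ "{}"] iu) (auto intro: add_nonneg_nonneg)
      also have "\<dots> \<le> (B 1 + B (- 1)) / R"
        using R(1) bound[of n 1] bound[of n "- 1"] int[of n 1] int[of n "- 1"]
        by (intro divide_right_mono) (auto simp: Bochner_Integration.integral_add)
      finally show ?thesis
        using R(2) \<mu>.prob_compl[of "{- R<..R}" n] by simp
    qed
    then show "\<exists>a b. a < b \<and> (\<forall>n. 1 - e < measure (\<mu> n) {a<..b})"
      using R(1) by (intro exI[of _ "- R"] exI[of _ R]) auto
  qed
  from tight_imp_convergent_subsubsequence[OF this strict_mono_id] obtain r D
    where r: "strict_mono (r :: nat \<Rightarrow> nat)" and D: "real_distribution D" and conv: "weak_conv_m (\<mu> \<circ> r) D"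
    by auto
  interpret D: real_distribution D by fact
  have "integrable D (\<lambda>x. exp (t * x))" for t
  proof -
    \<comment> \<open>Weak convergence applies to each truncation; monotone convergence in
      \<open>j\<close> then recovers the full exponential.\<close>
    let ?g = "\<lambda>j x. min (exp (t * x)) (real j)"
    have ig: "integrable N (?g j)" if "real_distribution N" for N j
    proof -
      interpret real_distribution N by fact
      show ?thesis by (rule integrable_const_bound[where B = "real j"]) auto
    qed
    have "(\<lambda>n. \<integral>x. ?g j x \<partial>(\<mu> \<circ> r) n) \<longlonglongrightarrow> (\<integral>x. ?g j x \<partial>D)" for j
      using \<mu> D conv[unfolded comp_def]
      by (intro weak_conv_imp_integral_bdd_continuous_conv[where B = "real j"]) (auto intro!: continuous_intros)
    moreover have "(\<integral>x. ?g j x \<partial>(\<mu> \<circ> r) n) \<le> B t" for j n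
      unfolding comp_def
      by (rule order_trans[OF integral_mono[OF ig[OF \<mu>] int] bound]) simp
    ultimately have le: "(\<integral>x. ?g j x \<partial>D) \<le> B t" for j
      by (blast intro: LIMSEQ_le_const2)
    have "mono (\<lambda>j. \<integral>x. ?g j x \<partial>D)"
      by (intro monoI integral_mono ig D) (auto simp: min_def)
    then obtain L where L: "(\<lambda>j. \<integral>x. ?g j x \<partial>D) \<longlonglongrightarrow> L"
      using incseq_convergent[of "\<lambda>j. \<integral>x. ?g j x \<partial>D"] le by blast
    show ?thesis
    proof (rule integrable_monotone_convergence[OF ig[OF D] _ _ L])
      show "AE x in D. mono (\<lambda>j. ?g j x)" by (intro AE_I2 monoI) (auto simp: min_def)
      show "AE x in D. (\<lambda>j. ?g j x) \<longlonglongrightarrow> exp (t * x)"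
      proof (rule AE_I2)
        fix x
        obtain j0 where "exp (t * x) \<le> real j0" using real_arch_simple by blast
        then have "\<forall>\<^sub>F j in sequentially. ?g j x = exp (t * x)"
          by (intro eventually_sequentiallyI[of j0]) (auto simp: min_def)
        then show "(\<lambda>j. ?g j x) \<longlonglongrightarrow> exp (t * x)" by (rule tendsto_eventually)
      qed
    qed simp
  qed
  with r D conv that show ?thesis by blast
qed

subsection \<open>The two processes\<close>

lemma GBP_prob:
  assumes "GBP_II_star H c M X" "finite A" "A \<subseteq> {1..}"
  shows "measure M {\<omega>\<in>space M. \<forall>i\<in>A. X i \<omega> = 1} = c ^ card A * Lcirc H (insert 0 A)"
proof -
  have "measure M {\<omega>\<in>space M. (\<forall>i\<in>A. X i \<omega> = 1) \<and> (\<forall>i\<in>{}. X i \<omega> = 0)} = c ^ card A * Dcirc H c (A \<union> {0}) {}"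
    using assms unfolding GBP_II_star_def by blast
  then show ?thesis by (simp add: Dcirc_def)
qed

text \<open>For x in {0, 1}, exp(isx) = 1 + x w with w = exp(is) - 1. Expanding the product over
  \<open>i\<close> gives a sum over subsets A of w^|A| times the probability of ones on A, and
  grouping by size produces the gap sums.\<close>

lemma GBP_char:
  assumes gbp: "GBP_II_star H c M X"
  shows "(CLINT \<omega>|M. iexp (s * (\<Sum>i=1..n. X i \<omega>)))
    = (\<Sum>k. (iexp s - 1) ^ k * of_real (c ^ k * gap_sum (2 * H - 1) k n))"
proof -
  interpret prob_space M using gbp by (simp add: GBP_II_star_def)
  have X: "X i \<in> borel_measurable M" "\<And>\<omega>. \<omega> \<in> space M \<Longrightarrow> X i \<omega> \<in> {0, 1}" if "i \<ge> 1" for i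
    using gbp that by (auto simp: GBP_II_star_def)
  let ?w = "iexp s - 1"
  let ?I = "{0<..n}"
  let ?E = "\<lambda>A. {\<omega>\<in>space M. \<forall>i\<in>A. X i \<omega> = 1}"
  have E: "?E A \<in> sets M" if "A \<in> Pow ?I" for A
  proof -
    have "finite A" using that finite_subset by blast
    have "X i \<in> borel_measurable M" if "i \<in> A" for i using X(1) that \<open>A \<in> Pow ?I\<close> by force
    then show ?thesis using \<open>finite A\<close> by measurable
  qed
  have "(CLINT \<omega>|M. iexp (s * (\<Sum>i=1..n. X i \<omega>))) = (CLINT \<omega>|M. \<Sum>A\<in>Pow ?I. of_real (indicator (?E A) \<omega>) * ?w ^ card A)"
  proof (rule Bochner_Integration.integral_cong)
    fix \<omega> assume \<omega>: "\<omega> \<in> space M"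
    have "iexp (s * (\<Sum>i=1..n. X i \<omega>)) = (\<Prod>i\<in>?I. iexp (s * X i \<omega>))"
      unfolding sum_distrib_left of_real_sum
      by (subst exp_sum[symmetric]) (auto simp: atLeastSucAtMost_greaterThanAtMost)
    also have "\<dots> = (\<Prod>i\<in>?I. of_real (X i \<omega>) * ?w + 1)"
    proof (rule prod.cong)
      fix i assume "i \<in> ?I"
      then have "X i \<omega> = 0 \<or> X i \<omega> = 1" using X(2)[of i \<omega>] \<omega> by auto
      then show "iexp (s * X i \<omega>) = of_real (X i \<omega>) * ?w + 1" by auto
    qed simp
    also have "\<dots> = (\<Sum>A\<in>Pow ?I. (\<Prod>i\<in>A. of_real (X i \<omega>) * ?w) * (\<Prod>i\<in>?I - A. 1))"
      by (rule prod_add) simp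
    also have "\<dots> = (\<Sum>A\<in>Pow ?I. of_real (indicator (?E A) \<omega>) * ?w ^ card A)"
    proof (rule sum.cong)
      fix A assume A: "A \<in> Pow ?I"
      then have "finite A" using finite_subset by blast
      have "(\<Prod>i\<in>A. complex_of_real (X i \<omega>)) = of_real (indicator (?E A) \<omega>)"
      proof (cases "\<forall>i\<in>A. X i \<omega> = 1")
        case False
        then obtain i where i: "i \<in> A" "X i \<omega> \<noteq> 1" by blast
        then have "X i \<omega> = 0" using A X(2)[of i \<omega>] \<omega> by auto
        then show ?thesis using False \<open>finite A\<close> i(1) by (auto simp: indicator_def)
      qed (use \<omega> in auto)
      then show "(\<Prod>i\<in>A. of_real (X i \<omega>) * ?w) * (\<Prod>i\<in>?I - A. 1) = of_real (indicator (?E A) \<omega>) * ?w ^ card A"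
        by (simp add: prod.distrib)
    qed simp
    finally show "iexp (s * (\<Sum>i=1..n. X i \<omega>)) = (\<Sum>A\<in>Pow ?I. of_real (indicator (?E A) \<omega>) * ?w ^ card A)" .
  qed simp
  also have "\<dots> = (\<Sum>A\<in>Pow ?I. ?w ^ card A * of_real (prob (?E A)))"
    using E by (subst Bochner_Integration.integral_sum)
      (auto intro!: sum.cong integrable_mult_left integrable_of_real simp: less_top[symmetric] Int_absorb2)
  also have "\<dots> = (\<Sum>A\<in>Pow ?I. ?w ^ card A * of_real (c ^ card A * Lcirc H (insert 0 A)))"
    by (intro sum.cong arg_cong[of _ _ "\<lambda>x. _ * of_real x"] GBP_prob[OF gbp] refl)
       (auto intro: finite_subset)
  also have "\<dots> = (\<Sum>k\<le>n. \<Sum>A | A \<in> Pow ?I \<and> card A = k. ?w ^ card A * of_real (c ^ card A * Lcirc H (insert 0 A)))"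
    using card_mono[of ?I] by (intro sum.group[symmetric]) auto
  also have "\<dots> = (\<Sum>k\<le>n. ?w ^ k * of_real (c ^ k * (\<Sum>A | A \<subseteq> ?I \<and> card A = k. Lcirc H (insert 0 A))))"
    by (simp add: sum_distrib_left)
  also have "\<dots> = (\<Sum>k\<le>n. ?w ^ k * of_real (c ^ k * gap_sum (2 * H - 1) k n))"
    by (simp add: sum_Lcirc)
  \<comment> \<open>More than \<open>n\<close> positive gaps cannot fit, so the finite sum already
    is the whole series.\<close>
  also have "\<dots> = (\<Sum>k. ?w ^ k * of_real (c ^ k * gap_sum (2 * H - 1) k n))"
    by (rule suminf_finite[symmetric]) (auto simp: gap_sum_eq_0)
  finally show ?thesis .
qed

section \<open>Binomial moments of the fractional Poisson process\<close>

text \<open>This half-line is the range of exp(t) - 1 for real t, where the moment generating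
  function supplies information.\<close>

lemma islimpt_of_real_greaterThan: "(0 :: complex) islimpt (of_real ` {-1<..})"
  unfolding islimpt_approachable
proof (intro allI impI)
  fix e :: real assume "e > 0"
  then show "\<exists>x'\<in>complex_of_real ` {-1<..}. x' \<noteq> 0 \<and> dist x' 0 < e"
    by (intro bexI[of _ "of_real (e / 2)"]) (auto simp del: of_real_divide)
qed

text \<open>Setting t = ln(1 + r) turns the moment generating function into the expectation of (1 +
  r)^K for real r > -1. Comparing power series in r identifies the binomial moments, and the
  identity extends to every complex \<open>w\<close>.\<close>

lemma frac_poisson_power_expectation:
  fixes w :: complex
  assumes fp: "frac_poisson \<mu> \<nu> M N" and \<mu>: "0 < \<mu>" "\<mu> < 1" and s: "s \<ge> 0"
  shows "(\<lambda>k. of_real ((\<nu> * s powr \<mu>) ^ k / Gamma (\<mu> * real k + 1)) * w ^ k)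
      sums (\<integral>\<omega>. (1 + w) ^ nat \<lfloor>N s \<omega>\<rfloor> \<partial>M)"
proof -
  let ?K = "\<lambda>\<omega>. nat \<lfloor>N s \<omega>\<rfloor>"
  let ?c = "\<lambda>k. (\<nu> * s powr \<mu>) ^ k / Gamma (\<mu> * real k + 1)"
  have [measurable]: "N s \<in> borel_measurable M" using fp s by (simp add: frac_poisson_def)
  have K: "real (?K \<omega>) = N s \<omega>" if "\<omega> \<in> space M" for \<omega>
  proof -
    have "N s \<omega> \<in> \<nat>" using fp s that by (simp add: frac_poisson_def)
    then show ?thesis by (auto elim!: Nats_cases)
  qed
  have power_K: "(1 + r) ^ ?K \<omega> = exp (ln (1 + r) * N s \<omega>)" if "\<omega> \<in> space M" "r > -1" for r :: real and \<omega>
    using exp_of_nat_mult[of "?K \<omega>" "ln (1 + r)"] K[OF that(1)] that(2) by (simp add: mult.commute)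
  have int: "integrable M (\<lambda>\<omega>. (1 + r) ^ ?K \<omega>)"
    and eq: "(\<integral>\<omega>. (1 + r) ^ ?K \<omega> \<partial>M) = (\<Sum>k. (r * \<nu> * s powr \<mu>) ^ k / Gamma (\<mu> * real k + 1))"
    if "r > -1" for r :: real
  proof -
    have 1: "integrable M (\<lambda>\<omega>. exp (t * N s \<omega>))"
      "(\<integral>\<omega>. exp (t * N s \<omega>) \<partial>M) = (\<Sum>k. ((exp t - 1) * \<nu> * s powr \<mu>) ^ k / Gamma (\<mu> * k + 1))" for t
      using fp s unfolding frac_poisson_def by blast+
    show "integrable M (\<lambda>\<omega>. (1 + r) ^ ?K \<omega>)"
      using 1(1)[of "ln (1 + r)"] by (subst Bochner_Integration.integrable_cong[OF refl power_K]) (use that in auto)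
    show "(\<integral>\<omega>. (1 + r) ^ ?K \<omega> \<partial>M) = (\<Sum>k. (r * \<nu> * s powr \<mu>) ^ k / Gamma (\<mu> * real k + 1))"
      using 1(2)[of "ln (1 + r)"] that by (subst Bochner_Integration.integral_cong[OF refl power_K]) (use that in auto)
  qed
  have sums: "(\<lambda>k. of_real (\<integral>\<omega>. real (?K \<omega> choose k) \<partial>M) * z ^ k) sums (\<integral>\<omega>. (1 + z) ^ ?K \<omega> \<partial>M)" for z :: complex
    by (rule sums_one_plus_power_expectation) (auto intro: int)
  have summ: "summable (\<lambda>k. complex_of_real (?c k) * z ^ k)" for z
    using summable_norm_cancel[OF summable_mittag_leffler_complex[OF \<mu>, of z "\<nu> * s powr \<mu>"]]
    by (simp add: mult.commute)
  have "(\<lambda>k. complex_of_real (\<integral>\<omega>. real (?K \<omega> choose k) \<partial>M)) = (\<lambda>k. of_real (?c k))"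
  proof (rule power_series_coeffs_eqI[OF sums_summable[OF sums] summ _ _ islimpt_of_real_greaterThan])
    fix z assume "z \<in> complex_of_real ` {-1<..}"
    then obtain r where r: "z = of_real r" "r > -1" by auto
    have "summable (\<lambda>k. ?c k * r ^ k)"
      using summable_mittag_leffler[OF \<mu>, of "\<nu> * s powr \<mu> * r"] by (simp add: power_mult_distrib)
    then have "(\<Sum>k. complex_of_real (?c k) * z ^ k) = of_real (\<Sum>k. ?c k * r ^ k)"
      unfolding r by (subst suminf_of_real) auto
    also have "(\<Sum>k. ?c k * r ^ k) = (\<integral>\<omega>. (1 + r) ^ ?K \<omega> \<partial>M)"
      unfolding eq[OF r(2)] by (simp add: power_mult_distrib mult_ac)
    also have "of_real \<dots> = (\<integral>\<omega>. (1 + z) ^ ?K \<omega> \<partial>M)"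
      unfolding r by (simp flip: integral_complex_of_real)
    finally show "(\<Sum>k. complex_of_real (\<integral>\<omega>. real (?K \<omega> choose k) \<partial>M) * z ^ k) = (\<Sum>k. complex_of_real (?c k) * z ^ k)"
      using sums_unique[OF sums[of z]] by simp
  qed (auto intro: image_eqI[of _ _ 0])
  then have "complex_of_real (\<integral>\<omega>. real (?K \<omega> choose k) \<partial>M) = of_real (?c k)" for k
    by (rule fun_cong)
  then have moments: "(\<integral>\<omega>. real (?K \<omega> choose k) \<partial>M) = ?c k" for k
    by (simp only: of_real_eq_iff)
  then show "(\<lambda>k. of_real (?c k) * w ^ k) sums (\<integral>\<omega>. (1 + w) ^ ?K \<omega> \<partial>M)"
    using sums[of w] by simp
qed

section \<open>Moment generating function versus characteristic function\<close>

lemma islimpt_range_of_real: "(0 :: complex) islimpt range of_real"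
  by (rule islimpt_subset[OF islimpt_of_real_greaterThan]) auto

lemma islimpt_range_imaginary: "(0 :: complex) islimpt range (\<lambda>t. \<i> * of_real t)"
  unfolding islimpt_approachable
proof (intro allI impI)
  fix e :: real assume "e > 0"
  then show "\<exists>x'\<in>range (\<lambda>t. \<i> * complex_of_real t). x' \<noteq> 0 \<and> dist x' 0 < e"
    by (intro bexI[of _ "\<i> * of_real (e / 2)"]) (auto simp: norm_mult simp del: of_real_divide)
qed

lemma char_eq_exp: "char D t = (\<integral>x. exp (\<i> * of_real t * of_real x) \<partial>D)"
  by (simp add: char_def mult.assoc)

context
  fixes \<mu> \<nu> :: real
  assumes \<mu>: "0 < \<mu>" "\<mu> < 1"
begin

lemma summable_mittag_leffler_powser:
  fixes z :: complex
  shows "summable (\<lambda>k. of_real (\<nu> ^ k / Gamma (\<mu> * real k + 1)) * z ^ k)"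
  using summable_norm_cancel[OF summable_mittag_leffler_complex[OF \<mu>, of z \<nu>]] by (simp add: mult.commute)

lemma of_real_mittag_leffler:
  "complex_of_real (mittag_leffler \<mu> (\<nu> * t))
    = (\<Sum>k. of_real (\<nu> ^ k / Gamma (\<mu> * real k + 1)) * of_real t ^ k)"
  unfolding mittag_leffler_def
  using summable_mittag_leffler[OF \<mu>, of "\<nu> * t"]
  by (subst suminf_of_real) (simp_all add: power_mult_distrib)

text \<open>Both transforms evaluate the same moment series, at t and at it, so either one fixes its
  coefficients. The forward direction serves an arbitrary limit law, the backward one the
  construction of such a law.\<close>

lemma has_mgf_iff_char_mittag_leffler:
  assumes D: "real_distribution D" and int: "\<And>t. integrable D (\<lambda>x. exp (t * x))"
  shows "has_mgf D (\<lambda>t. mittag_leffler \<mu> (\<nu> * t)) \<longleftrightarrow>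
    (\<forall>t. char D t = (\<Sum>k. of_real (\<nu> ^ k / Gamma (\<mu> * real k + 1)) * (\<i> * of_real t) ^ k))"
proof -
  let ?c = "\<lambda>k. \<nu> ^ k / Gamma (\<mu> * real k + 1)"
  let ?m = "\<lambda>k. (\<integral>x. x ^ k \<partial>D) / fact k"
  note sums = sums_exp_moments[OF D int]
  have mgf: "of_real (\<integral>x. exp (t * x) \<partial>D) = (\<Sum>k. of_real (?m k) * complex_of_real t ^ k)" for t
    using sums_unique[OF sums[of "of_real t"]]
    by (simp add: exp_of_real flip: of_real_mult integral_complex_of_real)
  have chr: "char D t = (\<Sum>k. of_real (?m k) * (\<i> * complex_of_real t) ^ k)" for t
    unfolding char_eq_exp by (rule sums_unique[OF sums])
  show ?thesis
  proof
    assume "has_mgf D (\<lambda>t. mittag_leffler \<mu> (\<nu> * t))"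
    then have "(\<Sum>k. of_real (?m k) * z ^ k) = (\<Sum>k. of_real (?c k) * z ^ k)" if "z \<in> range complex_of_real" for z
      using that mgf of_real_mittag_leffler by (auto simp: has_mgf_def)
    then have "(\<lambda>k. complex_of_real (?m k)) = (\<lambda>k. of_real (?c k))"
      by (intro power_series_coeffs_eqI[OF sums_summable[OF sums] summable_mittag_leffler_powser _ _ islimpt_range_of_real])
         (auto intro: range_eqI[of _ _ 0])
    then have "complex_of_real (?m k) = of_real (?c k)" for k by (rule fun_cong)
    then show "\<forall>t. char D t = (\<Sum>k. of_real (?c k) * (\<i> * of_real t) ^ k)"
      unfolding chr by (simp only: simp_thms)
  next
    assume "\<forall>t. char D t = (\<Sum>k. of_real (?c k) * (\<i> * of_real t) ^ k)"
    then have "(\<Sum>k. of_real (?m k) * z ^ k) = (\<Sum>k. of_real (?c k) * z ^ k)"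
      if "z \<in> range (\<lambda>t. \<i> * complex_of_real t)" for z
      using that chr by auto
    then have "(\<lambda>k. complex_of_real (?m k)) = (\<lambda>k. of_real (?c k))"
      by (intro power_series_coeffs_eqI[OF sums_summable[OF sums] summable_mittag_leffler_powser _ _ islimpt_range_imaginary])
         (auto intro: range_eqI[of _ _ 0])
    then have "complex_of_real (?m k) = of_real (?c k)" for k by (rule fun_cong)
    then have "complex_of_real (\<integral>x. exp (t * x) \<partial>D) = of_real (mittag_leffler \<mu> (\<nu> * t))" for t
      unfolding mgf of_real_mittag_leffler by (simp only:)
    then show "has_mgf D (\<lambda>t. mittag_leffler \<mu> (\<nu> * t))"
      unfolding has_mgf_def of_real_eq_iff using int by blast
  qed
qed

lemma char_tendsto_mittag_leffler:
  assumes bound: "\<And>n k. n > 0 \<Longrightarrow> \<bar>b n k\<bar> \<le> \<nu> ^ k / Gamma (\<mu> * real k + 1) * real n powr (\<mu> * real k)"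
    and lim: "\<And>k. (\<lambda>n. b n k / real n powr (\<mu> * real k)) \<longlonglongrightarrow> \<nu> ^ k / Gamma (\<mu> * real k + 1)"
  shows "(\<lambda>n. \<Sum>k. (iexp (t / real n powr \<mu>) - 1) ^ k * of_real (b n k))
    \<longlonglongrightarrow> (\<Sum>k. of_real (\<nu> ^ k / Gamma (\<mu> * real k + 1)) * (\<i> * of_real t) ^ k)"
proof -
  have "summable (\<lambda>k. \<bar>t\<bar> ^ k * (\<nu> ^ k / Gamma (\<mu> * real k + 1)))"
    using summable_mittag_leffler[OF \<mu>, of "\<bar>t\<bar> * \<nu>"] by (simp add: power_mult_distrib)
  from scaled_char_tendsto[OF \<mu>(1) bound lim this] show ?thesis
    by (simp only: mult.commute)
qed

end

section \<open>Limits of the rescaled characteristic functions\<close>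

text \<open>\<open>gap_sum_upper\<close> and \<open>gap_sum_tendsto\<close> supply domination and
  termwise limits; the factor c^k Gamma(\<mu>)^k explains the choice \<nu> = c Gamma(\<mu>).\<close>

lemma GBP_char_tendsto:
  assumes H: "1/2 < H" "H < 1" and c: "0 < c" and gbp: "GBP_II_star H c M X"
  defines "\<mu> \<equiv> 2 * H - 1"
  shows "(\<lambda>n. char (distr M borel (\<lambda>\<omega>. (\<Sum>i=1..n. X i \<omega>) / real n powr \<mu>)) t)
    \<longlonglongrightarrow> (\<Sum>k. of_real ((c * Gamma \<mu>) ^ k / Gamma (\<mu> * real k + 1)) * (\<i> * of_real t) ^ k)"
proof -
  have \<mu>: "0 < \<mu>" "\<mu> < 1" using H by (auto simp: \<mu>_def)
  have meas: "(\<lambda>\<omega>. (\<Sum>i=1..n. X i \<omega>) / real n powr \<mu>) \<in> borel_measurable M" for n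
    using gbp by (intro borel_measurable_divide borel_measurable_sum) (auto simp: GBP_II_star_def)
  have "char (distr M borel (\<lambda>\<omega>. (\<Sum>i=1..n. X i \<omega>) / real n powr \<mu>)) t
      = (\<Sum>k. (iexp (t / real n powr \<mu>) - 1) ^ k * of_real (c ^ k * gap_sum \<mu> k n))" for n
    using GBP_char[OF gbp, of "t / real n powr \<mu>" n]
    unfolding char_def by (subst integral_distr[OF meas]) (simp_all add: \<mu>_def)
  moreover have "(\<lambda>n. \<Sum>k. (iexp (t / real n powr \<mu>) - 1) ^ k * of_real (c ^ k * gap_sum \<mu> k n))
      \<longlonglongrightarrow> (\<Sum>k. of_real ((c * Gamma \<mu>) ^ k / Gamma (\<mu> * real k + 1)) * (\<i> * of_real t) ^ k)"
  proof (rule char_tendsto_mittag_leffler[OF \<mu>])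
    show "\<bar>c ^ k * gap_sum \<mu> k n\<bar> \<le> (c * Gamma \<mu>) ^ k / Gamma (\<mu> * real k + 1) * real n powr (\<mu> * real k)"
      if "n > 0" for n k
    proof -
      have "rpow (real n) (\<mu> * real k) = real n powr (\<mu> * real k)" using that by (simp add: rpow_def)
      then have "c ^ k * gap_sum \<mu> k n \<le> c ^ k * (Gamma \<mu> ^ k / Gamma (\<mu> * real k + 1) * real n powr (\<mu> * real k))"
        using gap_sum_upper[OF \<mu>, of k n] c by (intro mult_left_mono) auto
      then show ?thesis using c gap_sum_nonneg[of \<mu> k n] by (simp add: power_mult_distrib abs_mult)
    qed
    show "(\<lambda>n. c ^ k * gap_sum \<mu> k n / real n powr (\<mu> * real k)) \<longlonglongrightarrow> (c * Gamma \<mu>) ^ k / Gamma (\<mu> * real k + 1)" for k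
      using tendsto_mult_left[OF gap_sum_tendsto[OF \<mu>, of k], of "c ^ k"] by (simp add: power_mult_distrib)
  qed
  ultimately show ?thesis by simp
qed

text \<open>The binomial moments are exact multiples of powers of n^\<mu>, so for n > 0 the rescaled
  coefficients do not depend on n and the required bound is an equality.\<close>

lemma frac_poisson_char_tendsto:
  assumes \<mu>: "0 < \<mu>" "\<mu> < 1" and \<nu>: "0 < \<nu>" and fp: "frac_poisson \<mu> \<nu> M N"
  shows "(\<lambda>n. char (distr M borel (\<lambda>\<omega>. N (real n) \<omega> / real n powr \<mu>)) t)
    \<longlonglongrightarrow> (\<Sum>k. of_real (\<nu> ^ k / Gamma (\<mu> * real k + 1)) * (\<i> * of_real t) ^ k)"
proof -
  let ?b = "\<lambda>n k. (\<nu> * real n powr \<mu>) ^ k / Gamma (\<mu> * real k + 1)"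
  have b: "?b n k = \<nu> ^ k / Gamma (\<mu> * real k + 1) * real n powr (\<mu> * real k)" if "n > 0" for n k
    using that by (simp add: power_mult_distrib powr_powr[symmetric] powr_realpow)
  have [measurable]: "N (real n) \<in> borel_measurable M" for n
    using fp by (simp add: frac_poisson_def)
  have "char (distr M borel (\<lambda>\<omega>. N (real n) \<omega> / real n powr \<mu>)) t
      = (\<Sum>k. (iexp (t / real n powr \<mu>) - 1) ^ k * of_real (?b n k))" for n
  proof -
    have "char (distr M borel (\<lambda>\<omega>. N (real n) \<omega> / real n powr \<mu>)) t
        = (\<integral>\<omega>. iexp (t * (N (real n) \<omega> / real n powr \<mu>)) \<partial>M)"
      unfolding char_def by (subst integral_distr) simp_all
    also have "\<dots> = (\<integral>\<omega>. (1 + (iexp (t / real n powr \<mu>) - 1)) ^ nat \<lfloor>N (real n) \<omega>\<rfloor> \<partial>M)"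
    proof (rule Bochner_Integration.integral_cong)
      fix \<omega> assume "\<omega> \<in> space M"
      then have "N (real n) \<omega> \<in> \<nat>" using fp by (simp add: frac_poisson_def)
      then obtain j where j: "N (real n) \<omega> = real j" by (elim Nats_cases)
      show "iexp (t * (N (real n) \<omega> / real n powr \<mu>)) = (1 + (iexp (t / real n powr \<mu>) - 1)) ^ nat \<lfloor>N (real n) \<omega>\<rfloor>"
        unfolding j by (simp add: exp_of_nat_mult[symmetric] mult_ac)
    qed simp
    also have "\<dots> = (\<Sum>k. (iexp (t / real n powr \<mu>) - 1) ^ k * of_real (?b n k))"
      using sums_unique[OF frac_poisson_power_expectation[OF fp \<mu>, of "real n" "iexp (t / real n powr \<mu>) - 1"]]
      by (simp only: of_nat_0_le_iff mult.commute)
    finally show ?thesis .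
  qed
  moreover have "(\<lambda>n. \<Sum>k. (iexp (t / real n powr \<mu>) - 1) ^ k * of_real (?b n k))
    \<longlonglongrightarrow> (\<Sum>k. of_real (\<nu> ^ k / Gamma (\<mu> * real k + 1)) * (\<i> * of_real t) ^ k)"
  proof (rule char_tendsto_mittag_leffler[OF \<mu>])
    show "\<bar>?b n k\<bar> \<le> \<nu> ^ k / Gamma (\<mu> * real k + 1) * real n powr (\<mu> * real k)" if "n > 0" for n k
      unfolding b[OF that] using \<nu> \<mu> Gamma_mittag_leffler_pos[of \<mu> k] by (simp add: abs_mult)
    show "(\<lambda>n. ?b n k / real n powr (\<mu> * real k)) \<longlonglongrightarrow> \<nu> ^ k / Gamma (\<mu> * real k + 1)" for k
    proof (rule tendsto_eventually)
      show "\<forall>\<^sub>F n in sequentially. ?b n k / real n powr (\<mu> * real k) = \<nu> ^ k / Gamma (\<mu> * real k + 1)"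
        using eventually_gt_at_top[of 0] by eventually_elim (simp add: b)
    qed
  qed
  ultimately show ?thesis by simp
qed

section \<open>Existence of the limit law\<close>

text \<open>At y = t / s with s at least 1, this bounds s |exp(t / s) - 1| by |t| exp |t|, uniformly
  in s.\<close>

lemma abs_exp_minus_1_le: "\<bar>exp y - 1\<bar> \<le> \<bar>y\<bar> * exp \<bar>y\<bar>" for y :: real
proof (cases "y \<ge> 0")
  case True
  have "1 - y \<le> exp (- y)" using exp_ge_add_one_self[of "- y"] by simp
  then have "(1 - y) * exp y \<le> exp (- y) * exp y" by (intro mult_right_mono) auto
  then show ?thesis using True by (simp add: algebra_simps flip: exp_add)
next
  case False
  then have "1 - exp y \<le> - y * 1" using exp_ge_add_one_self[of y] by linarith
  also have "\<dots> \<le> - y * exp (- y)" using False by (intro mult_left_mono) auto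
  finally show ?thesis using False by simp
qed

text \<open>The exponential moments of N(n) / n^\<mu> are bounded uniformly in n, so a subsequence
  converges weakly to a law with all exponential moments. Its characteristic function is forced by
  \<open>frac_poisson_char_tendsto\<close> and determines its moment generating function.\<close>

lemma mittag_leffler_law_exists:
  assumes \<mu>: "0 < \<mu>" "\<mu> < 1" and \<nu>: "0 < \<nu>" and fp: "frac_poisson \<mu> \<nu> M N"
  shows "\<exists>D. real_distribution D \<and> has_mgf D (\<lambda>t. mittag_leffler \<mu> (\<nu> * t))"
proof -
  interpret prob_space M using fp by (simp add: frac_poisson_def)
  let ?D = "\<lambda>n. distr M borel (\<lambda>\<omega>. N (real n) \<omega> / real n powr \<mu>)"
  let ?\<psi> = "\<lambda>t. \<Sum>k. complex_of_real (\<nu> ^ k / Gamma (\<mu> * real k + 1)) * (\<i> * of_real t) ^ k"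
  have [measurable]: "N (real n) \<in> borel_measurable M" for n
    using fp by (simp add: frac_poisson_def)
  have meas: "(\<lambda>\<omega>. N (real n) \<omega> / real n powr \<mu>) \<in> borel_measurable M" for n
    by measurable
  have D: "real_distribution (?D n)" for n by simp
  have N: "integrable M (\<lambda>\<omega>. exp (t * N (real n) \<omega>))"
    "(\<integral>\<omega>. exp (t * N (real n) \<omega>) \<partial>M) = (\<Sum>k. ((exp t - 1) * \<nu> * real n powr \<mu>) ^ k / Gamma (\<mu> * k + 1))" for t n
    using fp of_nat_0_le_iff[of n] unfolding frac_poisson_def by blast+
  have int: "integrable (?D n) (\<lambda>x. exp (t * x))" for n t
    using N(1)[of "t / real n powr \<mu>" n] by (subst integrable_distr_eq[OF meas]) simp_all
  \<comment> \<open>Indexing by \<open>Suc n\<close> keeps the scale \<open>s\<close> at least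
    1.\<close>
  have bound: "(\<integral>x. exp (t * x) \<partial>?D (Suc n)) \<le> mittag_leffler \<mu> (\<bar>t\<bar> * exp \<bar>t\<bar> * \<nu>)" for n t
  proof -
    define s where "s = real (Suc n) powr \<mu>"
    have s: "s \<ge> 1" unfolding s_def using \<mu> by (intro ge_one_powr_ge_zero) auto
    have "(\<integral>x. exp (t * x) \<partial>?D (Suc n)) = (\<integral>\<omega>. exp (t / s * N (real (Suc n)) \<omega>) \<partial>M)"
      unfolding s_def by (subst integral_distr[OF meas]) simp_all
    also have "\<dots> = (\<Sum>k. ((exp (t / s) - 1) * \<nu> * s) ^ k / Gamma (\<mu> * real k + 1))"
      unfolding N(2) s_def ..
    also have "\<dots> \<le> mittag_leffler \<mu> (\<bar>t\<bar> * exp \<bar>t\<bar> * \<nu>)"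
      unfolding mittag_leffler_def
    proof (intro suminf_le summable_mittag_leffler \<mu> divide_right_mono)
      fix k
      have "\<bar>exp (t / s) - 1\<bar> \<le> \<bar>t / s\<bar> * exp \<bar>t / s\<bar>" by (rule abs_exp_minus_1_le)
      also have "\<dots> \<le> \<bar>t / s\<bar> * exp \<bar>t\<bar>"
        using s mult_left_mono[of 1 s "\<bar>t\<bar>"] by (intro mult_left_mono) (auto simp: divide_simps)
      finally have "\<bar>exp (t / s) - 1\<bar> * s \<le> \<bar>t\<bar> * exp \<bar>t\<bar>" using s by (simp add: field_simps)
      then have "\<bar>exp (t / s) - 1\<bar> * s * \<nu> \<le> \<bar>t\<bar> * exp \<bar>t\<bar> * \<nu>" using \<nu> by (intro mult_right_mono) auto
      \<comment> \<open>The base is negative for t < 0, so powers are compared through absolute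
        values.\<close>
      then have "\<bar>(exp (t / s) - 1) * \<nu> * s\<bar> ^ k \<le> (\<bar>t\<bar> * exp \<bar>t\<bar> * \<nu>) ^ k"
        using s \<nu> by (intro power_mono) (auto simp: abs_mult mult_ac)
      then show "((exp (t / s) - 1) * \<nu> * s) ^ k \<le> (\<bar>t\<bar> * exp \<bar>t\<bar> * \<nu>) ^ k"
        unfolding power_abs[symmetric] by linarith
      show "0 \<le> Gamma (\<mu> * real k + 1)" using \<mu> Gamma_mittag_leffler_pos[of \<mu> k] by simp
    qed
    finally show ?thesis .
  qed
  obtain r D'
    where r: "strict_mono (r :: nat \<Rightarrow> nat)" and D': "real_distribution D'"
      and conv: "weak_conv_m ((\<lambda>n. ?D (Suc n)) \<circ> r) D'" and int': "\<And>t. integrable D' (\<lambda>x. exp (t * x))"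
    by (rule tight_weak_limit_exp[of "\<lambda>n. ?D (Suc n)", OF D int bound]) iprover
  have "char D' t = ?\<psi> t" for t
  proof (rule LIMSEQ_unique)
    show "(\<lambda>n. char (((\<lambda>n. ?D (Suc n)) \<circ> r) n) t) \<longlonglongrightarrow> char D' t"
      using D by (intro levy_continuity1[OF _ D' conv]) (simp del: of_nat_Suc)
    show "(\<lambda>n. char (((\<lambda>n. ?D (Suc n)) \<circ> r) n) t) \<longlonglongrightarrow> ?\<psi> t"
      using LIMSEQ_subseq_LIMSEQ[OF LIMSEQ_Suc[OF frac_poisson_char_tendsto[OF assms, of t]] r]
      by (simp only: comp_def)
  qed
  then have "has_mgf D' (\<lambda>t. mittag_leffler \<mu> (\<nu> * t))"
    by (intro has_mgf_iff_char_mittag_leffler[OF \<mu> D' int', THEN iffD2] allI)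
  with D' show ?thesis by blast
qed

text \<open>The limit variable is represented by its law. Existence is a separate conjunct, so
  convergence to every law with this moment generating function is not vacuous.\<close>

theorem theorem3p3:
  fixes H c :: real and M :: "'a measure" and X :: "nat \<Rightarrow> 'a \<Rightarrow> real"
    and M' :: "'b measure" and N :: "real \<Rightarrow> 'b \<Rightarrow> real"
  assumes "1/2 < H" "H < 1" "0 < c" "c < 2 powr (2 * H - 2)"
    and "GBP_II_star H c M X"
    and "frac_poisson (2 * H - 1) (c * Gamma (2 * H - 1)) M' N"
  shows "(\<exists>D. real_distribution D \<and> has_mgf D (\<lambda>t. mittag_leffler (2 * H - 1) (c * Gamma (2 * H - 1) * t)))
    \<and> (\<forall>D. real_distribution D \<and> has_mgf D (\<lambda>t. mittag_leffler (2 * H - 1) (c * Gamma (2 * H - 1) * t)) \<longrightarrow>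
        weak_conv_m (\<lambda>n. distr M borel (\<lambda>\<omega>. (\<Sum>i=1..n. X i \<omega>) / real n powr (2 * H - 1))) D
      \<and> weak_conv_m (\<lambda>n. distr M' borel (\<lambda>\<omega>. N (real n) \<omega> / real n powr (2 * H - 1))) D)"
proof (intro conjI allI impI; (elim conjE)?)
  interpret M: prob_space M using assms(5) by (simp add: GBP_II_star_def)
  interpret M': prob_space M' using assms(6) by (simp add: frac_poisson_def)
  have \<mu>: "0 < 2 * H - 1" "2 * H - 1 < 1" using assms(1,2) by auto
  have \<nu>: "0 < c * Gamma (2 * H - 1)" using assms(3) \<mu> by (simp add: Gamma_real_pos)
  show "\<exists>D. real_distribution D \<and> has_mgf D (\<lambda>t. mittag_leffler (2 * H - 1) (c * Gamma (2 * H - 1) * t))"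
    by (rule mittag_leffler_law_exists[OF \<mu> \<nu> assms(6)])
  fix D assume D: "real_distribution D"
    and mgf: "has_mgf D (\<lambda>t. mittag_leffler (2 * H - 1) (c * Gamma (2 * H - 1) * t))"
  \<comment> \<open>The moment generating function determines the characteristic function of the
    arbitrary law \<open>D\<close>, so Levy's theorem only needs the limits proved above.\<close>
  have "integrable D (\<lambda>x. exp (t * x))" for t
    using mgf by (simp add: has_mgf_def)
  from spec[OF iffD1[OF has_mgf_iff_char_mittag_leffler[OF \<mu> D this] mgf]]
  have char: "char D t = (\<Sum>k. of_real ((c * Gamma (2 * H - 1)) ^ k / Gamma ((2 * H - 1) * real k + 1)) * (\<i> * of_real t) ^ k)" for t .
  show "weak_conv_m (\<lambda>n. distr M borel (\<lambda>\<omega>. (\<Sum>i=1..n. X i \<omega>) / real n powr (2 * H - 1))) D"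
  proof (rule levy_continuity[OF _ D])
    have "(\<lambda>\<omega>. (\<Sum>i=1..n. X i \<omega>) / real n powr (2 * H - 1)) \<in> borel_measurable M" for n
      using assms(5) by (intro borel_measurable_divide borel_measurable_sum) (auto simp: GBP_II_star_def)
    then show "real_distribution (distr M borel (\<lambda>\<omega>. (\<Sum>i=1..n. X i \<omega>) / real n powr (2 * H - 1)))" for n
      by (rule M.real_distribution_distr)
  qed (unfold char, rule GBP_char_tendsto[OF assms(1-3,5)])
  show "weak_conv_m (\<lambda>n. distr M' borel (\<lambda>\<omega>. N (real n) \<omega> / real n powr (2 * H - 1))) D"
  proof (rule levy_continuity[OF _ D])
    have "(\<lambda>\<omega>. N (real n) \<omega> / real n powr (2 * H - 1)) \<in> borel_measurable M'" for n
      using assms(6) by (intro borel_measurable_divide) (auto simp: frac_poisson_def)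
    then show "real_distribution (distr M' borel (\<lambda>\<omega>. N (real n) \<omega> / real n powr (2 * H - 1)))" for n
      by (rule M'.real_distribution_distr)
  qed (unfold char, rule frac_poisson_char_tendsto[OF \<mu> \<nu> assms(6)])
qed

end
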